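(* Fix a positive integer $n$ and let $\nu$ be a word of length $n-1$ in the alphabet $\{U,D\}$. Let $\mathcal{T}^\ell_{n,\nu}$ be the set of labeled plane binary trees on $n$ nodes with canopy $\nu$. Then the generating function $$G_{n,\nu}=\sum_{T\in\mathcal{T}^\ell_{n,\nu}}\bar\lambda^{\mathrm{lasc}(T)}\lambda^{\mathrm{ldes}(T)}\bar\rho^{\,\mathrm{rasc}(T)}\rho^{\,\mathrm{rdes}(T)}\,\mathsf{x}^T$$ is Schur positive, i.e. it is a sum of Schur functions in $\mathsf{x}$ with coefficients in $\mathbb{N}[\bar\lambda,\lambda,\bar\rho,\rho]$.
   Context: A (plane binary) tree is a rooted tree in which every node has at most one left child and at most one right child (it may have only one of the two), and no other children. A labeled tree is a tree whose nodes are labeled with positive integers, repetitions allowed. Write $v^\ell$ for the label of a node $v$. If $v$ is the left child of $w$, the edge between them is a left ascent if $v^\ell\le w^\ell$ and a left descent otherwise. If $w$ is the right child of $v$, the edge between them is a right ascent if $v^\ell\le w^\ell$ and a right descent otherwise. Let $\mathrm{lasc}(T),\mathrm{ldes}(T),\mathrm{rasc}(T),\mathrm{rdes}(T)$ be the numbers of left ascents, left descents, right ascents and right descents of $T$. Let $\mathsf{x}=\{x_1,x_2,\dots\}$ and $\bar\lambda,\lambda,\bar\rho,\rho$ be commuting indeterminates, and $\mathsf{x}^T=\prod_{v\in T}x_{v^\ell}$. The inorder traversal of a tree recursively visits the left subtree of the root in inorder, then the root, then the right subtree in inorder. The canopy of a tree on $n$ nodes $v_1,\dots,v_n$ (listed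 in inorder) is the word of length $n-1$ on $\{U,D\}$ whose $i$th letter ($1\le i\le n-1$) is $D$ if $v_i$ has a right child and $U$ otherwise. *)

theory Defs
  imports Main "HOL-Library.Tree" "HOL-Library.Poly_Mapping"
begin

text \<open>
  Plane binary trees are those of the library: \<^const>\<open>Leaf\<close> is the empty tree (an absent child),
  so \<^const>\<open>size\<close> counts the nodes.  Labels are natural numbers; their positivity is imposed in
  \<open>labeled_trees\<close> below.
\<close>

fun lasc :: "nat tree \<Rightarrow> nat" where
  "lasc Leaf = 0"
| "lasc (Node l a r) =
     (case l of Leaf \<Rightarrow> 0 | Node _ b _ \<Rightarrow> if b \<le> a then 1 else 0) + lasc l + lasc r"

fun ldes :: "nat tree \<Rightarrow> nat" where
  "ldes Leaf = 0"
| "ldes (Node l a r) =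
     (case l of Leaf \<Rightarrow> 0 | Node _ b _ \<Rightarrow> if b \<le> a then 0 else 1) + ldes l + ldes r"

fun rasc :: "nat tree \<Rightarrow> nat" where
  "rasc Leaf = 0"
| "rasc (Node l a r) =
     (case r of Leaf \<Rightarrow> 0 | Node _ b _ \<Rightarrow> if a \<le> b then 1 else 0) + rasc l + rasc r"

fun rdes :: "nat tree \<Rightarrow> nat" where
  "rdes Leaf = 0"
| "rdes (Node l a r) =
     (case r of Leaf \<Rightarrow> 0 | Node _ b _ \<Rightarrow> if a \<le> b then 0 else 1) + rdes l + rdes r"

datatype letter = U | D

text \<open>The nodes in inorder, each represented by the subtree rooted at it.\<close>

fun inorder_nodes :: "'a tree \<Rightarrow> 'a tree list" where
  "inorder_nodes Leaf = []"
| "inorder_nodes (Node l a r) = inorder_nodes l @ Node l a r # inorder_nodes r"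

definition canopy :: "'a tree \<Rightarrow> letter list" where
  "canopy t = map (\<lambda>v. if right v \<noteq> Leaf then D else U) (butlast (inorder_nodes t))"

definition labeled_trees :: "nat \<Rightarrow> letter list \<Rightarrow> nat tree set" where
  "labeled_trees n \<nu> = {t. size t = n \<and> (\<forall>a\<in>set_tree t. 0 < a) \<and> canopy t = \<nu>}"

text \<open>
  A monomial in \<open>x\<^sub>1, x\<^sub>2, \<dots>\<close> is its finitely supported exponent function (the index \<open>0\<close> is never
  used), and a formal power series in \<open>x\<close> is the function assigning to each monomial its coefficient.
\<close>

type_synonym x_monomial = "nat \<Rightarrow>\<^sub>0 nat"

definition tree_monomial :: "nat tree \<Rightarrow> x_monomial" where
  "tree_monomial t = (\<Sum>a\<leftarrow>inorder t. Poly_Mapping.single a 1)"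

datatype weight_var = Lambda_bar | Lambda | Rho_bar | Rho

text \<open>The semiring of polynomials with natural number coefficients in the four weight variables.\<close>

type_synonym weight_poly = "(weight_var \<Rightarrow>\<^sub>0 nat) \<Rightarrow>\<^sub>0 nat"

definition var :: "weight_var \<Rightarrow> weight_poly" where
  "var v = Poly_Mapping.single (Poly_Mapping.single v 1) 1"

definition weight :: "nat tree \<Rightarrow> weight_poly" where
  "weight t = var Lambda_bar ^ lasc t * var Lambda ^ ldes t * var Rho_bar ^ rasc t * var Rho ^ rdes t"

definition tree_gf :: "nat \<Rightarrow> letter list \<Rightarrow> x_monomial \<Rightarrow> weight_poly" where
  "tree_gf n \<nu> m = (\<Sum>t | t \<in> labeled_trees n \<nu> \<and> tree_monomial t = m. weight t)"

definition is_partition :: "nat list \<Rightarrow> bool" where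
  "is_partition \<mu> \<longleftrightarrow> sorted_wrt (\<ge>) \<mu> \<and> (\<forall>k\<in>set \<mu>. 0 < k)"

definition diagram :: "nat list \<Rightarrow> (nat \<times> nat) set" where
  "diagram \<mu> = {(i, j). i < length \<mu> \<and> j < \<mu> ! i}"

text \<open>
  Semistandard Young tableaux, with cells addressed as (row, column).  The value \<open>0\<close> outside the
  diagram makes a tableau determined by its entries.
\<close>

definition ssyt :: "nat list \<Rightarrow> (nat \<times> nat \<Rightarrow> nat) set" where
  "ssyt \<mu> = {T.
     (\<forall>c\<in>diagram \<mu>. 0 < T c) \<and> (\<forall>c. c \<notin> diagram \<mu> \<longrightarrow> T c = 0) \<and>
     (\<forall>i j j'. (i, j) \<in> diagram \<mu> \<longrightarrow> (i, j') \<in> diagram \<mu> \<longrightarrow> j \<le> j' \<longrightarrow> T (i, j) \<le> T (i, j')) \<and>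
     (\<forall>i i' j. (i, j) \<in> diagram \<mu> \<longrightarrow> (i', j) \<in> diagram \<mu> \<longrightarrow> i < i' \<longrightarrow> T (i, j) < T (i', j))}"

definition tableau_monomial :: "nat list \<Rightarrow> (nat \<times> nat \<Rightarrow> nat) \<Rightarrow> x_monomial" where
  "tableau_monomial \<mu> T = (\<Sum>c\<in>diagram \<mu>. Poly_Mapping.single (T c) 1)"

definition schur :: "nat list \<Rightarrow> x_monomial \<Rightarrow> nat" where
  "schur \<mu> m = card {T \<in> ssyt \<mu>. tableau_monomial \<mu> T = m}"

definition schur_positive :: "(x_monomial \<Rightarrow> weight_poly) \<Rightarrow> bool" where
  "schur_positive F \<longleftrightarrow>
     (\<exists>c :: nat list \<Rightarrow>\<^sub>0 weight_poly.
        (\<forall>\<mu>\<in>Poly_Mapping.keys c. is_partition \<mu>) \<and>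
        (\<forall>m. F m = (\<Sum>\<mu>\<in>Poly_Mapping.keys c. Poly_Mapping.lookup c \<mu> * of_nat (schur \<mu> m))))"

text \<open>The sum in \<open>tree_gf\<close> and the cardinality in \<open>schur\<close> range over finite sets:\<close>

lemma keys_tree_monomial: "Poly_Mapping.keys (tree_monomial t) = set_tree t"
proof -
  have "Poly_Mapping.lookup (\<Sum>a\<leftarrow>xs. Poly_Mapping.single a (1::nat)) i = count_list xs i"
    for xs :: "nat list" and i
    by (induction xs) (auto simp: lookup_add lookup_single when_def)
  then have "i \<in> Poly_Mapping.keys (tree_monomial t) \<longleftrightarrow> i \<in> set_tree t" for i
    by (simp add: tree_monomial_def in_keys_iff count_list_0_iff)
  then show ?thesis by blast
qed

lemma finite_trees: "finite A \<Longrightarrow> finite {t. size t = n \<and> set_tree t \<subseteq> A}"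
proof (induction n rule: less_induct)
  case (less n)
  let ?S = "\<Union>k<n. {t. size t = k \<and> set_tree t \<subseteq> A}"
  have "{t. size t = n \<and> set_tree t \<subseteq> A} \<subseteq> insert Leaf ((\<lambda>(l, a, r). Node l a r) ` (?S \<times> A \<times> ?S))"
  proof
    fix t assume "t \<in> {t. size t = n \<and> set_tree t \<subseteq> A}"
    then show "t \<in> insert Leaf ((\<lambda>(l, a, r). Node l a r) ` (?S \<times> A \<times> ?S))"
      by (cases t) (auto simp: image_iff)
  qed
  moreover have "finite ?S" using less by auto
  ultimately show ?case using less.prems by (meson finite_SigmaI finite_imageI finite_insert finite_subset)
qed

lemma finite_labeled_trees_monomial: "finite {t. t \<in> labeled_trees n \<nu> \<and> tree_monomial t = m}"
  by (rule finite_subset[OF _ finite_trees[of "Poly_Mapping.keys m" n]])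
    (auto simp: labeled_trees_def keys_tree_monomial)

lemma finite_diagram: "finite (diagram \<mu>)"
  by (rule finite_subset[of _ "\<Union>i<length \<mu>. {i} \<times> {..<\<mu> ! i}"]) (auto simp: diagram_def)

lemma finite_ssyt_monomial: "finite {T \<in> ssyt \<mu>. tableau_monomial \<mu> T = m}"
proof (rule finite_subset)
  have "T c \<in> Poly_Mapping.keys m" if "tableau_monomial \<mu> T = m" "c \<in> diagram \<mu>" for T c
  proof -
    have "Poly_Mapping.lookup m (T c) = (\<Sum>d\<in>diagram \<mu>. if T d = T c then 1 else 0)"
      unfolding that(1)[symmetric] tableau_monomial_def
      by (simp add: lookup_sum lookup_single when_def del: One_nat_def)
    also have "\<dots> \<noteq> 0"
      using that(2) by (auto simp: sum_eq_0_iff[OF finite_diagram])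
    finally show ?thesis by (simp add: in_keys_iff)
  qed
  then show "{T \<in> ssyt \<mu>. tableau_monomial \<mu> T = m} \<subseteq>
      {T. \<forall>c. (c \<in> diagram \<mu> \<longrightarrow> T c \<in> Poly_Mapping.keys m) \<and> (c \<notin> diagram \<mu> \<longrightarrow> T c = 0)}"
    by (auto simp: ssyt_def)
  show "finite {T. \<forall>c. (c \<in> diagram \<mu> \<longrightarrow> T c \<in> Poly_Mapping.keys m) \<and> (c \<notin> diagram \<mu> \<longrightarrow> T c = (0::nat))}"
    by (rule finite_set_of_finite_funs) (auto simp: finite_diagram)
qed

end

theory Submission
  imports Defs "HOL-Library.Multiset"
begin

text \<open>
  Fix the labels in inorder and a canopy.  A leaf between the nodes \<open>x\<close> and \<open>w\<close> shows up as a factor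
  \<open>D U\<close> of the canopy, and it is either the right child of \<open>x\<close> or the left child of \<open>w\<close>, so
  the total weight of the trees satisfies
  \<open>F(\<dots> x D z U w \<dots>) = R(x,z) F(\<dots> x U w \<dots>) + L(z,w) F(\<dots> x D w \<dots>)\<close>,
  where \<open>L\<close> and \<open>R\<close> are the weights of a left and of a right edge.  The same recursion holds for the sum
  over all noncrossing partial matchings of letters \<open>D\<close> with later letters \<open>U\<close> in the canopy, where an
  unmatched letter joins its two neighbouring nodes with weight \<open>L\<close> or \<open>R\<close>, and a matched pair joins the
  nodes just outside of it with weight \<open>L R\<close>.  For each matching the joined nodes form disjoint paths,
  so that after rearranging the labels along these paths its weight depends only on the descent set of the
  resulting word.  By Robinson--Schensted--Knuth insertion, which turns descents of a word into descents of
  its recording tableau, the words with a given descent set have a Schur positive generating function.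
\<close>

section \<open>Row insertion\<close>

text \<open>The last argument is the index of the row that becomes longer.\<close>

inductive ins :: "'a::linorder \<Rightarrow> 'a list list \<Rightarrow> 'a list list \<Rightarrow> nat \<Rightarrow> bool" where
  ins_new: "ins y [] [[y]] 0"
| ins_end: "R \<noteq> [] \<Longrightarrow> \<forall>a\<in>set R. a \<le> y \<Longrightarrow> ins y (R # P) ((R @ [y]) # P) 0"
| ins_bump: "\<forall>a\<in>set A. a \<le> y \<Longrightarrow> y < b \<Longrightarrow> ins b P P' r \<Longrightarrow>
    ins y ((A @ b # C) # P) ((A @ y # C) # P') (Suc r)"

inductive_cases ins_NilE: "ins y [] P' r"
inductive_cases ins_ConsE: "ins y (R # P) P' r"
inductive_cases ins_0E: "ins y P P' 0"

text \<open>Makes the bumped entry unique: it is the first one exceeding the inserted letter. The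
  mirror image \<open>last_split_unique\<close> serves reverse insertion, which ejects the last
  entry smaller than the letter coming up.\<close>

lemma first_split_unique:
  assumes "A @ b # C = A' @ b' # C'" "\<forall>a\<in>set A. \<not> Q a" "Q b" "\<forall>a\<in>set A'. \<not> Q a" "Q b'"
  shows "A = A' \<and> b = b' \<and> C = C'"
  using assms
proof (induction A arbitrary: A')
  case Nil
  then show ?case by (cases A') auto
next
  case (Cons a A)
  then show ?case by (cases A') auto
qed

lemma last_split_unique:
  assumes "A @ b # C = A' @ b' # C'" "\<forall>c\<in>set C. \<not> Q c" "Q b" "\<forall>c\<in>set C'. \<not> Q c" "Q b'"
  shows "A = A' \<and> b = b' \<and> C = C'"
  using assms
proof (induction A arbitrary: A')
  case Nil
  then show ?case by (cases A') auto
next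
  case (Cons a A)
  then show ?case by (cases A') auto
qed

lemma ins_exists: "\<exists>P' r. ins y P P' r" if "\<forall>R\<in>set P. R \<noteq> []"
  using that
proof (induction P arbitrary: y)
  case Nil
  then show ?case using ins_new by blast
next
  case (Cons R P)
  show ?case
  proof (cases "\<exists>b\<in>set R. y < b")
    case True
    then obtain A b C where R: "R = A @ b # C" "y < b" "\<forall>a\<in>set A. \<not> y < a"
      using split_list_first_prop[of R "\<lambda>b. y < b"] by blast
    obtain P' r where "ins b P P' r" using Cons by fastforce
    then show ?thesis using R by (metis ins_bump linorder_not_less)
  next
    case False
    then show ?thesis using Cons.prems by (metis ins_end linorder_not_less list.set_intros(1))
  qed
qed

lemma ins_unique: "ins y P P1 r1 \<Longrightarrow> ins y P P2 r2 \<Longrightarrow> P1 = P2 \<and> r1 = r2"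
proof (induction y P P1 r1 arbitrary: P2 r2 rule: ins.induct)
  case (ins_bump A y b P P' r C)
  from ins_bump.prems show ?case
  proof (cases rule: ins.cases)
    case (ins_bump A' b' P'' r' C')
    have "A = A' \<and> b = b' \<and> C = C'"
      by (rule first_split_unique[where Q = "\<lambda>a. y < a"])
        (use ins_bump \<open>\<forall>a\<in>set A. a \<le> y\<close> \<open>y < b\<close> in \<open>auto simp: not_less\<close>)
    then show ?thesis using ins_bump ins_bump.IH by blast
  qed (use ins_bump.hyps in auto)
qed (force elim: ins_NilE ins_ConsE)+

section \<open>Shapes and tableaux under row insertion\<close>

fun grow :: "nat \<Rightarrow> nat list \<Rightarrow> nat list" where
  "grow 0 [] = [1]"
| "grow 0 (a # \<mu>) = Suc a # \<mu>"
| "grow (Suc r) [] = []"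
| "grow (Suc r) (a # \<mu>) = a # grow r \<mu>"

lemma ins_shape: "ins y P P' r \<Longrightarrow> map length P' = grow r (map length P) \<and> r \<le> length P"
  by (induction rule: ins.induct) auto

lemma ins_mset: "ins y P P' r \<Longrightarrow> mset (concat P') = add_mset y (mset (concat P))"
  by (induction rule: ins.induct) auto

fun above :: "'a::linorder list \<Rightarrow> 'a list list \<Rightarrow> bool" where
  "above R [] = True"
| "above R (S # P) = (length S \<le> length R \<and> (\<forall>j<length S. R ! j < S ! j))"

fun tableau :: "'a::linorder list list \<Rightarrow> bool" where
  "tableau [] = True"
| "tableau (R # P) = (R \<noteq> [] \<and> sorted R \<and> above R P \<and> tableau P)"

lemma tableau_shape: "tableau P \<Longrightarrow> is_partition (map length P)"
proof (induction P)
  case (Cons R P)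
  then show ?case by (cases P) (fastforce simp: is_partition_def)+
qed (simp add: is_partition_def)

text \<open>The second conjunct carries the column condition through the induction: a row in which
  \<open>x\<close> has displaced \<open>y\<close> stays above the rows that receive
  \<open>y\<close>, because \<open>y\<close> lands weakly to the left of the column it came
  from.\<close>

lemma ins_tableau:
  "ins y P P' r \<Longrightarrow> tableau P \<Longrightarrow> tableau P' \<and>
    (\<forall>A x C. x < y \<longrightarrow> (\<forall>a\<in>set A. a \<le> x) \<longrightarrow> above (A @ y # C) P \<longrightarrow> above (A @ x # C) P')"
proof (induction rule: ins.induct)
  case (ins_new y)
  have "(A @ x # C) ! 0 < y" if "x < y" "\<forall>a\<in>set A. a \<le> x" for A x C
    using that by (cases A) (auto intro: le_less_trans)
  then show ?case by auto
next
  case (ins_end R y P)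
  have 1: "above (R @ [y]) P"
    using ins_end.prems by (cases P) (auto simp: nth_append)
  have "above (A @ x # C) ((R @ [y]) # P)"
    if h: "x < y" "\<forall>a\<in>set A. a \<le> x" "above (A @ y # C) (R # P)" for A x C
  proof -
    \<comment> \<open>Otherwise the entry of \<open>R\<close> below the old place of
      \<open>y\<close> would exceed \<open>y\<close>.\<close>
    have le: "length R \<le> length A"
    proof (rule ccontr)
      assume "\<not> ?thesis"
      then have "length A < length R" by simp
      then have "(A @ y # C) ! length A < R ! length A" "R ! length A \<in> set R" using h(3) by auto
      then show False using ins_end.hyps(2) by fastforce
    qed
    have "(A @ x # C) ! j < (R @ [y]) ! j" if "j \<le> length R" for j
    proof (cases "j < length R")
      case True
      then show ?thesis using h(3) le by (auto simp: nth_append)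
    next
      case False
      then have "j = length R" using that by simp
      then show ?thesis using h le by (cases "length R = length A") (auto simp: nth_append intro: le_less_trans)
    qed
    then show ?thesis using le by (auto simp: less_Suc_eq_le)
  qed
  then show ?case using ins_end 1 by (auto simp: sorted_append simp del: above.simps)
next
  case (ins_bump A y b P P' r C)
  have sorted: "sorted (A @ y # C)"
    using ins_bump.prems ins_bump.hyps by (fastforce simp: sorted_append)
  have "above (A0 @ x # C0) ((A @ y # C) # P')"
    if h: "x < y" "\<forall>a\<in>set A0. a \<le> x" "above (A0 @ y # C0) ((A @ b # C) # P)" for A0 x C0
  proof -
    have lt: "(A0 @ y # C0) ! j < (A @ b # C) ! j" if "j < length (A @ b # C)" for j
      using h(3) that by simp
    have le: "length A \<le> length A0"
    proof (rule ccontr)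
      assume "\<not> ?thesis"
      then have "length A0 < length A" by simp
      then have "y < A ! length A0" "A ! length A0 \<in> set A"
        using lt[of "length A0"] by (auto simp: nth_append)
      then show False using ins_bump.hyps(1) by fastforce
    qed
    have "(A0 @ x # C0) ! j < (A @ y # C) ! j" if j: "j < length (A @ y # C)" for j
    proof (cases "j = length A")
      case True
      then show ?thesis using h le by (cases "length A = length A0") (auto simp: nth_append intro: le_less_trans)
    next
      case False
      have "(A0 @ x # C0) ! j \<le> (A0 @ y # C0) ! j" using h(1) by (auto simp: nth_append nth_Cons')
      also have "\<dots> < (A @ b # C) ! j" using lt j by simp
      also have "\<dots> = (A @ y # C) ! j" using False by (auto simp: nth_append nth_Cons')
      finally show ?thesis .
    qed
    then show ?thesis using h(3) by simp
  qed
  then show ?case using ins_bump sorted by (auto simp: sorted_append simp del: above.simps)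
qed

text \<open>In reverse bumping \<open>y\<close> ejects the last entry smaller than itself. Column
  strictness gives \<open>R ! k < S ! k \<le> y\<close>, so that entry lies in column
  \<open>k\<close> or further right.\<close>

lemma above_split:
  assumes "above R (S # P)" "sorted R" "k < length S" "S ! k \<le> y"
  obtains A x C where "R = A @ x # C" "x < y" "\<forall>c\<in>set C. y \<le> c" "k \<le> length A"
proof -
  have *: "k < length R" "R ! k < y" using assms by auto
  then obtain A x C where R: "R = A @ x # C" "x < y" "\<forall>c\<in>set C. \<not> c < y"
    using split_list_last_prop[of R "\<lambda>x. x < y"] nth_mem by blast
  have "k \<le> length A"
  proof (rule ccontr)
    assume "\<not> ?thesis"
    then have "R ! k \<in> set C" using R(1) *(1) by (auto simp: nth_append nth_Cons')
    then show False using R(3) * by blast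
  qed
  then show ?thesis using that R by (auto simp: not_less)
qed

text \<open>Reverse insertion: the last cell of row \<open>r\<close> is removed and its entry bumps
  upwards until the top row ejects \<open>y\<close>. The final clause, dual to that of
  \<open>ins_tableau\<close>, lets one more row on top take in \<open>y\<close> and eject
  \<open>x\<close>; the induction needs it.\<close>

lemma ins_surj:
  "tableau P' \<Longrightarrow> map length P' = grow r \<mu> \<Longrightarrow> is_partition \<mu> \<Longrightarrow> r \<le> length \<mu> \<Longrightarrow>
   \<exists>y P. ins y P P' r \<and> tableau P \<and> map length P = \<mu> \<and>
     (\<forall>R. above R P' \<longrightarrow> sorted R \<longrightarrow>
        (\<exists>A x C. R = A @ x # C \<and> x < y \<and> (\<forall>c\<in>set C. y \<le> c) \<and> above (A @ y # C) P))"
proof (induction r \<mu> arbitrary: P' rule: grow.induct)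
  case 1
  then obtain y where P': "P' = [[y]]" by (auto simp: map_eq_Cons_conv length_Suc_conv)
  have "\<exists>A x C. R = A @ x # C \<and> x < y \<and> (\<forall>c\<in>set C. y \<le> c)" if "above R P'" "sorted R" for R
    by (rule above_split[of R "[y]" "[]" 0 y]) (use that P' in auto)
  then show ?case using P' ins_new[of y] by (intro exI[of _ y] exI[of _ "[]"]) auto
next
  case (2 m \<mu>)
  then obtain R' P where P': "P' = R' # P" "length R' = Suc m" "map length P = \<mu>"
    by (auto simp: map_eq_Cons_conv)
  then obtain R y where R': "R' = R @ [y]" "length R = m" by (metis length_Suc_conv_rev)
  \<comment> \<open>The shortened row has length \<open>m\<close>, a part of the partition, so it
    does not become empty.\<close>
  have m: "m > 0" using 2(3) by (auto simp: is_partition_def)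
  have "above R P"
    using 2 P' R' by (cases P) (auto simp: nth_append is_partition_def)
  then have "tableau (R # P)" using 2 P' R' m by (auto simp: sorted_append)
  moreover have "ins y (R # P) P' 0"
    using 2(1) P' R' m by (auto intro!: ins_end simp: sorted_append)
  moreover have "\<exists>A x C. R0 = A @ x # C \<and> x < y \<and> (\<forall>c\<in>set C. y \<le> c) \<and> above (A @ y # C) (R # P)"
    if h: "above R0 P'" "sorted R0" for R0
  proof -
    have h1: "above R0 ((R @ [y]) # P)" using h P' R' by simp
    obtain A x C where *: "R0 = A @ x # C" "x < y" "\<forall>c\<in>set C. y \<le> c" "length R \<le> length A"
      by (rule above_split[OF h1 h(2), of "length R" y]) auto
    have "(A @ y # C) ! j < R ! j" if "j < length R" for j
      using h1 that * by (auto simp: nth_append split: if_splits dest: spec[of _ j])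
    then show ?thesis using * by (intro exI[of _ A] exI[of _ x] exI[of _ C]) auto
  qed
  ultimately show ?case using P' R' by (intro exI[of _ y] exI[of _ "R # P"]) auto
next
  case (3 r)
  then show ?case by simp
next
  case (4 r m \<mu>)
  obtain R' P1' where P': "P' = R' # P1'" "length R' = m" "map length P1' = grow r \<mu>"
    using 4 by (auto simp: map_eq_Cons_conv)
  have part: "is_partition \<mu>" using 4 by (auto simp: is_partition_def)
  have t: "tableau P1'" "above R' P1'" "sorted R'" using 4 P' by auto
  obtain b P1 where b: "ins b P1 P1' r" "tableau P1" "map length P1 = \<mu>"
     "\<forall>R. above R P1' \<longrightarrow> sorted R \<longrightarrow>
        (\<exists>A x C. R = A @ x # C \<and> x < b \<and> (\<forall>c\<in>set C. b \<le> c) \<and> above (A @ b # C) P1)"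
    using 4 P' part t by fastforce
  obtain A y C where R': "R' = A @ y # C" "y < b" "\<forall>c\<in>set C. b \<le> c" "above (A @ b # C) P1"
    using b(4) t by blast
  have "tableau ((A @ b # C) # P1)"
    using b R' t by (auto simp: sorted_append intro: order.trans less_imp_le)
  moreover have "ins y ((A @ b # C) # P1) P' (Suc r)"
    unfolding P'(1) R'(1) using R' t b by (intro ins_bump) (auto simp: sorted_append)
  moreover have "\<exists>A0 x C0. R0 = A0 @ x # C0 \<and> x < y \<and> (\<forall>c\<in>set C0. y \<le> c) \<and>
       above (A0 @ y # C0) ((A @ b # C) # P1)"
    if h: "above R0 P'" "sorted R0" for R0
  proof -
    have h1: "above R0 ((A @ y # C) # P1')" using h P' R' by simp
    obtain A0 x C0 where *: "R0 = A0 @ x # C0" "x < y" "\<forall>c\<in>set C0. y \<le> c" "length A \<le> length A0"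
      by (rule above_split[OF h1 h(2), of "length A" y]) auto
    have lt: "(A0 @ x # C0) ! j < (A @ y # C) ! j" if "j < length (A @ y # C)" for j
      using h1 * that by simp
    have "(A0 @ y # C0) ! j < (A @ b # C) ! j" if j: "j < length (A @ b # C)" for j
    proof (cases "j = length A0")
      case True
      show ?thesis
      proof (cases "length A0 = length A")
        case False
        then have "(A @ b # C) ! j \<in> set C" using True j *(4) by (auto simp: nth_append nth_Cons')
        then show ?thesis using True R' by (auto simp: nth_append)
      qed (use True R' in \<open>auto simp: nth_append\<close>)
    next
      case False
      then have "(A0 @ y # C0) ! j = (A0 @ x # C0) ! j" by (auto simp: nth_append nth_Cons')
      also have "\<dots> < (A @ y # C) ! j" using lt j by simp
      also have "\<dots> \<le> (A @ b # C) ! j" using R'(2) by (auto simp: nth_append nth_Cons')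
      finally show ?thesis .
    qed
    moreover have "length (A @ b # C) \<le> length (A0 @ y # C0)" using h1 * by simp
    ultimately show ?thesis using * by (intro exI[of _ A0] exI[of _ x] exI[of _ C0]) auto
  qed
  ultimately show ?case using P' R' b by (intro exI[of _ y] exI[of _ "(A @ b # C) # P1"]) auto
qed

lemma ins_inj:
  "ins y P P' r \<Longrightarrow> ins y2 P2 P' r \<Longrightarrow> tableau P \<Longrightarrow> tableau P2 \<Longrightarrow> y = y2 \<and> P = P2"
proof (induction y P P' r arbitrary: y2 P2 rule: ins.induct)
  case (ins_bump A y b P P' r C)
  from ins_bump.prems(1) show ?case
  proof (cases rule: ins.cases)
    case (ins_bump A' b' Pa C')
    have b: "b' = b" "Pa = P" using ins_bump ins_bump.IH \<open>tableau P2\<close> \<open>tableau ((A @ b # C) # P)\<close> by auto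
    have "A = A' \<and> y = y2 \<and> C = C'"
      by (rule last_split_unique[where Q = "\<lambda>a. a < b"])
        (use ins_bump b \<open>y < b\<close> \<open>tableau P2\<close> \<open>tableau ((A @ b # C) # P)\<close> in \<open>auto simp: sorted_append\<close>)
    then show ?thesis using ins_bump b by simp
  qed
qed (auto elim!: ins_0E)

text \<open>The row bumping lemma. In each row the bumped entries compare like the inserted letters:
  if \<open>x \<le> y\<close>, then \<open>y\<close> bumps from the right of \<open>x\<close>, where
  all entries are at least \<open>b\<close>; if \<open>y < x\<close>, it bumps an entry that is at
  most \<open>x\<close>, hence below \<open>b\<close>.\<close>

lemma ins_ins_descent:
  "ins x P P1 r \<Longrightarrow> ins y P1 P2 s \<Longrightarrow> tableau P \<Longrightarrow> s \<le> r \<longleftrightarrow> x \<le> y"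
proof (induction x P P1 r arbitrary: y P2 s rule: ins.induct)
  case (ins_new x)
  from ins_new.prems(1) show ?case by (cases rule: ins.cases) (auto simp: Cons_eq_append_conv)
next
  case (ins_end R x P)
  from ins_end.prems(1) show ?case
  proof (cases rule: ins.cases)
    case (ins_bump A b P' r C)
    have "b \<in> set (R @ [x])" unfolding ins_bump by simp
    then have "b \<le> x" using ins_end.hyps by auto
    then show ?thesis using ins_bump by auto
  qed (use ins_end.hyps in auto)
next
  case (ins_bump A x b P P' r C)
  have s: "sorted (A @ b # C)" "tableau P" using ins_bump.prems by auto
  from ins_bump.prems(1) show ?case
  proof (cases rule: ins.cases)
    case (ins_bump A' b' P'' s' C')
    have IH: "s' \<le> r \<longleftrightarrow> b \<le> b'" using ins_bump ins_bump.IH s by blast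
    have "set (A @ x # C) = set (A' @ b' # C')" using ins_bump(1) by (rule arg_cong)
    then have "x \<in> set (A' @ b' # C')" "b' \<in> set (A @ x # C)" by auto
    moreover have "sorted (A' @ b' # C')"
      unfolding ins_bump(1)[symmetric]
      using \<open>\<forall>a\<in>set A. a \<le> x\<close> \<open>x < b\<close> s(1) by (auto simp: sorted_append)
    ultimately have "x \<le> y \<or> b' \<le> x" "b' \<in> set C \<or> b' \<le> x"
      using ins_bump(4) \<open>\<forall>a\<in>set A. a \<le> x\<close> by (auto simp: sorted_append)
    then have "b \<le> b' \<longleftrightarrow> x \<le> y"
      using \<open>y < b'\<close> \<open>x < b\<close> s(1) by (auto simp: sorted_append)
    then show ?thesis using IH ins_bump by simp
  qed (use ins_bump.hyps in auto)
qed


text \<open>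
  Words are inserted from right to left, and the recording tableau is stored as the list of the rows that
  become longer, the latest one first.
\<close>

inductive rsk :: "'a::linorder list \<Rightarrow> 'a list list \<Rightarrow> nat list \<Rightarrow> bool" where
  rsk_Nil: "rsk [] [] []"
| rsk_Cons: "rsk v P rs \<Longrightarrow> ins y P P' r \<Longrightarrow> rsk (y # v) P' (r # rs)"

inductive_cases rsk_ConsE: "rsk (y # v) P rs"
inductive_cases rsk_NilE: "rsk [] P rs"

fun growth_shape :: "nat list \<Rightarrow> nat list" where
  "growth_shape [] = []"
| "growth_shape (r # rs) = grow r (growth_shape rs)"

text \<open>Such a list encodes a standard Young tableau as a chain of partitions growing by one
  cell; the bound on \<open>r\<close> excludes the default value of \<open>grow\<close>.\<close>

fun growth :: "nat list \<Rightarrow> bool" where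
  "growth [] = True"
| "growth (r # rs) = (growth rs \<and> r \<le> length (growth_shape rs) \<and> is_partition (growth_shape (r # rs)))"

lemma rsk_invariants:
  "rsk v P rs \<Longrightarrow> tableau P \<and> map length P = growth_shape rs \<and> growth rs \<and>
    mset (concat P) = mset v \<and> length rs = length v"
proof (induction rule: rsk.induct)
  case (rsk_Cons v P rs y P' r)
  then have t: "tableau P'" using ins_tableau by blast
  have "length P = length (growth_shape rs)" using rsk_Cons by (metis length_map)
  then show ?case
    using rsk_Cons t tableau_shape[OF t] ins_shape[of y P P' r] ins_mset[of y P P' r] by auto
qed auto

lemma tableau_rows_nonempty: "tableau P \<Longrightarrow> R \<in> set P \<Longrightarrow> R \<noteq> []"
  by (induction P) auto

lemma rsk_exists: "\<exists>P rs. rsk v P rs"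
proof (induction v)
  case (Cons y v)
  then obtain P rs where "rsk v P rs" by blast
  moreover then obtain P' r where "ins y P P' r"
    using ins_exists rsk_invariants tableau_rows_nonempty by metis
  ultimately show ?case using rsk_Cons by blast
qed (use rsk_Nil in blast)

lemma rsk_unique: "rsk v P rs \<Longrightarrow> rsk v P' rs' \<Longrightarrow> P = P' \<and> rs = rs'"
proof (induction v P rs arbitrary: P' rs' rule: rsk.induct)
  case rsk_Nil
  then show ?case by (auto elim: rsk_NilE)
next
  case (rsk_Cons v P rs y Pa r)
  from rsk_Cons.prems show ?case
    by (rule rsk_ConsE) (use rsk_Cons ins_unique in blast)
qed

lemma rsk_inj: "rsk v P rs \<Longrightarrow> rsk v' P rs \<Longrightarrow> v = v'"
proof (induction v P rs arbitrary: v' rule: rsk.induct)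
  case rsk_Nil
  then show ?case by (auto elim: rsk.cases)
next
  case (rsk_Cons v P rs y Pa r)
  from rsk_Cons.prems show ?case
    by (cases rule: rsk.cases) (use rsk_Cons ins_inj rsk_invariants in blast)
qed

lemma growth_partition: "growth rs \<Longrightarrow> is_partition (growth_shape rs)"
  by (cases rs) (auto simp: is_partition_def)

text \<open>The head of \<open>rs\<close> names the row that grew last, so reverse insertion from
  that row recovers the first letter of the word.\<close>

lemma rsk_surj:
  "tableau P \<Longrightarrow> map length P = growth_shape rs \<Longrightarrow> growth rs \<Longrightarrow> \<exists>v. rsk v P rs"
proof (induction rs arbitrary: P)
  case Nil
  then show ?case using rsk_Nil by auto
next
  case (Cons r rs)
  then obtain y P0 where "ins y P0 P r" "tableau P0" "map length P0 = growth_shape rs"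
    using ins_surj[of P r "growth_shape rs"] growth_partition[of rs] by auto
  then show ?case using Cons rsk_Cons by (metis growth.simps(2))
qed

text \<open>
  The pair at the head of the list of weights belongs to the first two letters; excess entries of either
  list contribute the factor \<open>1\<close>.
\<close>

fun chain_weight :: "('a \<Rightarrow> 'a \<Rightarrow> bool) \<Rightarrow> ('w::comm_semiring_1 \<times> 'w) list \<Rightarrow> 'a list \<Rightarrow> 'w" where
  "chain_weight Q (k # ks) (a # b # xs) = (if Q a b then fst k else snd k) * chain_weight Q ks (b # xs)"
| "chain_weight Q _ _ = 1"

text \<open>Adjacent letters are consecutive insertions, the left one coming second, so
  \<open>ins_ins_descent\<close> turns their comparison into that of the recorded rows.\<close>

lemma chain_weight_rsk:
  "rsk v P rs \<Longrightarrow> chain_weight (\<ge>) ks v = chain_weight (\<le>) ks rs"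
proof (induction v P rs arbitrary: ks rule: rsk.induct)
  case outer: (rsk_Cons v P rs y P' r)
  show ?case
  proof (cases ks)
    case (Cons k ks')
    from outer(1) show ?thesis
    proof (cases rule: rsk.cases)
      case (rsk_Cons v0 P0 rs0 x r0)
      then have "r \<le> r0 \<longleftrightarrow> x \<le> y" using ins_ins_descent outer(2) rsk_invariants by blast
      then show ?thesis using outer.IH[of ks'] rsk_Cons Cons by simp
    qed (use Cons in auto)
  qed simp
qed simp

section \<open>Schur positivity of descent classes of words\<close>

definition word_monomial :: "nat list \<Rightarrow> x_monomial" where
  "word_monomial v = (\<Sum>a\<leftarrow>v. Poly_Mapping.single a 1)"

lemma word_monomial_mset: "mset v = mset w \<Longrightarrow> word_monomial v = word_monomial w"
  unfolding word_monomial_def by (metis mset_map sum_mset_sum_list)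

lemma keys_word_monomial: "Poly_Mapping.keys (word_monomial v) = set v"
proof -
  have "Poly_Mapping.lookup (word_monomial v) i = count_list v i" for i
    unfolding word_monomial_def by (induction v) (auto simp: lookup_add lookup_single when_def)
  then show ?thesis by (auto simp: in_keys_iff count_list_0_iff)
qed

section \<open>Words and tableaux of given content\<close>

definition words :: "nat \<Rightarrow> x_monomial \<Rightarrow> nat list set" where
  "words n m = {v. length v = n \<and> 0 \<notin> set v \<and> word_monomial v = m}"

lemma finite_words: "finite (words n m)"
  by (rule finite_subset[OF _ finite_lists_length_eq[of "Poly_Mapping.keys m" n]])
    (auto simp: words_def keys_word_monomial)

definition tableaux :: "nat list \<Rightarrow> x_monomial \<Rightarrow> nat list list set" where
  "tableaux \<mu> m = {P. tableau P \<and> map length P = \<mu> \<and> 0 \<notin> set (concat P) \<and> word_monomial (concat P) = m}"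

definition row_less :: "'a::linorder list \<Rightarrow> 'a list \<Rightarrow> bool" where
  "row_less R S \<longleftrightarrow> length S \<le> length R \<and> (\<forall>j<length S. R ! j < S ! j)"

lemma row_less_trans: "row_less R S \<Longrightarrow> row_less S T \<Longrightarrow> row_less R T"
  unfolding row_less_def by (meson dual_order.trans less_trans order_less_le_trans)

text \<open>\<open>tableau\<close> compares adjacent rows only, which suits insertion; transitivity
  of \<open>row_less\<close> extends this to all pairs of rows, as in \<open>ssyt\<close>.\<close>

lemma tableau_iff: "tableau P \<longleftrightarrow> (\<forall>R\<in>set P. R \<noteq> [] \<and> sorted R) \<and> sorted_wrt row_less P"
proof (induction P)
  case (Cons R P)
  have "above R P \<longleftrightarrow> (\<forall>S\<in>set P. row_less R S)" if "sorted_wrt row_less P"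
    using that by (cases P) (auto simp: row_less_def[symmetric] intro: row_less_trans)
  then show ?case using Cons by auto
qed simp

text \<open>Lists of rows and fillings that vanish outside the diagram encode the same objects;
  \<open>g\<close> and \<open>h\<close> translate between them and preserve the content.\<close>

lemma card_tableaux:
  assumes "is_partition \<mu>"
  shows "card (tableaux \<mu> m) = schur \<mu> m"
proof -
  define g where "g = (\<lambda>P (i, j). if (i, j) \<in> diagram \<mu> then P ! i ! j else (0::nat))"
  define h where "h = (\<lambda>T. map (\<lambda>i. map (\<lambda>j. T (i, j) :: nat) [0..<\<mu> ! i]) [0..<length \<mu>])"
  have mono: "tableau_monomial \<mu> (g P) = word_monomial (concat P)" if "map length P = \<mu>" for P
  proof -
    have d: "diagram \<mu> = Sigma {..<length P} (\<lambda>i. {..<length (P ! i)})"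
      using that by (auto simp: diagram_def)
    have "tableau_monomial \<mu> (g P) = (\<Sum>(i, j)\<in>diagram \<mu>. Poly_Mapping.single (P ! i ! j) 1)"
      unfolding tableau_monomial_def by (rule sum.cong) (auto simp: g_def)
    also have "\<dots> = (\<Sum>i<length P. \<Sum>j<length (P ! i). Poly_Mapping.single (P ! i ! j) 1)"
      unfolding d by (rule sum.Sigma[symmetric]) auto
    also have "\<dots> = (\<Sum>R\<leftarrow>P. \<Sum>a\<leftarrow>R. Poly_Mapping.single a 1)"
      by (simp add: sum_list_sum_nth atLeast0LessThan)
    also have "\<dots> = word_monomial (concat P)"
      unfolding word_monomial_def by (induction P) auto
    finally show ?thesis .
  qed
  have gh: "g (h T) = T" if "T \<in> ssyt \<mu>" for T
    using that by (auto simp: g_def h_def ssyt_def diagram_def fun_eq_iff)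
  have hg: "h (g P) = P" if "map length P = \<mu>" for P
    using that by (auto simp: g_def h_def diagram_def intro!: nth_equalityI)
  have sh: "map length (h T) = \<mu>" for T
    by (auto simp: h_def intro: nth_equalityI)
  have "bij_betw g (tableaux \<mu> m) {T \<in> ssyt \<mu>. tableau_monomial \<mu> T = m}"
  proof (rule bij_betw_byWitness[where f' = h])
    show "g ` tableaux \<mu> m \<subseteq> {T \<in> ssyt \<mu>. tableau_monomial \<mu> T = m}"
    proof
      fix T assume "T \<in> g ` tableaux \<mu> m"
      then obtain P where P: "T = g P" "tableau P" "map length P = \<mu>" "0 \<notin> set (concat P)"
        "word_monomial (concat P) = m" by (auto simp: tableaux_def)
      have d: "(i, j) \<in> diagram \<mu> \<longleftrightarrow> i < length P \<and> j < length (P ! i)" for i j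
        using P(3) by (auto simp: diagram_def)
      have v: "g P (i, j) = P ! i ! j" if "(i, j) \<in> diagram \<mu>" for i j
        using that by (simp add: g_def)
      have "0 < P ! i ! j" if "(i, j) \<in> diagram \<mu>" for i j
        using P(4) that unfolding d by (metis gr0I in_set_conv_nth concat.simps nth_mem set_concat UN_I)
      moreover have "sorted (P ! i)" if "i < length P" for i
        using P(2) that by (auto simp: tableau_iff)
      moreover have "P ! i ! j < P ! i' ! j" if "i < i'" "i' < length P" "j < length (P ! i')" for i i' j
        using P(2) that by (auto simp: tableau_iff sorted_wrt_iff_nth_less row_less_def)
      ultimately have "g P \<in> ssyt \<mu>"
        by (auto simp: ssyt_def g_def d sorted_nth_mono)
      then show "T \<in> {T \<in> ssyt \<mu>. tableau_monomial \<mu> T = m}" using P mono by auto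
    qed
    show "h ` {T \<in> ssyt \<mu>. tableau_monomial \<mu> T = m} \<subseteq> tableaux \<mu> m"
    proof
      fix P assume "P \<in> h ` {T \<in> ssyt \<mu>. tableau_monomial \<mu> T = m}"
      then obtain T where T: "P = h T" "T \<in> ssyt \<mu>" "tableau_monomial \<mu> T = m" by auto
      have pos: "\<mu> ! i > 0" if "i < length \<mu>" for i
        using assms that by (auto simp: is_partition_def)
      have dec: "\<mu> ! i' \<le> \<mu> ! i" if "i < i'" "i' < length \<mu>" for i i'
        using assms that by (auto simp: is_partition_def sorted_wrt_iff_nth_less)
      have "\<forall>R\<in>set (h T). R \<noteq> [] \<and> sorted R"
        using T(2) pos by (auto simp: h_def sorted_iff_nth_mono ssyt_def diagram_def)
      moreover have "sorted_wrt row_less (h T)"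
        using T(2) dec less_le_trans[OF _ dec] unfolding sorted_wrt_iff_nth_less row_less_def
        by (auto simp: h_def ssyt_def diagram_def)
      moreover have "0 \<notin> set (concat (h T))"
      proof -
        have "T (i, j) \<noteq> 0" if "(i, j) \<in> diagram \<mu>" for i j
          using T(2) that by (simp add: ssyt_def)
        then show ?thesis by (force simp: h_def diagram_def)
      qed
      moreover have "word_monomial (concat (h T)) = m"
        using mono[OF sh] gh T by metis
      ultimately show "P \<in> tableaux \<mu> m" using T sh by (simp add: tableaux_def tableau_iff)
    qed
  qed (auto simp: hg gh tableaux_def)
  then show ?thesis unfolding schur_def by (rule bij_betw_same_card)
qed

text \<open>With the recording list fixed, the insertion tableau ranges bijectively over all
  tableaux of that shape and has the content of the word.\<close>

lemma card_words_of_recording: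
  assumes "growth rs" "length rs = n"
  shows "card {v \<in> words n m. \<exists>P. rsk v P rs} = schur (growth_shape rs) m"
proof -
  define f where "f = (\<lambda>v :: nat list. THE P. rsk v P rs)"
  have f: "f v = P" if "rsk v P rs" for v P
    unfolding f_def using that rsk_unique by blast
  have wm: "word_monomial (concat P) = word_monomial v \<and> set (concat P) = set v" if "rsk v P rs" for v P
    using rsk_invariants[OF that] word_monomial_mset mset_eq_setD by metis
  have "bij_betw f {v \<in> words n m. \<exists>P. rsk v P rs} (tableaux (growth_shape rs) m)"
  proof (rule bij_betwI')
    fix v w assume "v \<in> {v \<in> words n m. \<exists>P. rsk v P rs}" "w \<in> {v \<in> words n m. \<exists>P. rsk v P rs}"
    then show "f v = f w \<longleftrightarrow> v = w" using f rsk_inj by auto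
  next
    fix v assume v: "v \<in> {v \<in> words n m. \<exists>P. rsk v P rs}"
    then obtain P where "rsk v P rs" by blast
    then show "f v \<in> tableaux (growth_shape rs) m"
      using f[of v P] wm[of v P] rsk_invariants[of v P rs] v by (auto simp: tableaux_def words_def)
  next
    fix P assume P: "P \<in> tableaux (growth_shape rs) m"
    have "\<exists>v. rsk v P rs" by (rule rsk_surj) (use P assms in \<open>auto simp: tableaux_def\<close>)
    then obtain v where v: "rsk v P rs" by blast
    then have "v \<in> words n m" using P wm[OF v] rsk_invariants[OF v] assms
      by (auto simp: tableaux_def words_def)
    then show "\<exists>v\<in>{v \<in> words n m. \<exists>P. rsk v P rs}. P = f v" using v f by auto
  qed
  then show ?thesis
    unfolding card_tableaux[OF growth_partition[OF assms(1)], symmetric] by (rule bij_betw_same_card)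
qed

lemma finite_growths: "finite {rs. growth rs \<and> length rs = n}"
proof -
  have len: "length (grow r \<mu>) \<le> Suc (length \<mu>)" for r \<mu>
    by (induction r \<mu> rule: grow.induct) auto
  have "length (growth_shape rs) \<le> length rs" for rs
    by (induction rs) (auto intro: order.trans[OF len])
  then have "set rs \<subseteq> {..length rs}" if "growth rs" for rs
    using that by (induction rs) (auto intro: order.trans le_SucI dest: order.trans subsetD)
  then show ?thesis
    by (intro finite_subset[OF _ finite_lists_length_eq[of "{..n}" n]]) auto
qed

text \<open>Grouping words by recording list makes the weight constant on each class, and the size
  of the class is a coefficient of a Schur function.\<close>

lemma sum_chain_weight_words:
  "(\<Sum>v\<in>words n m. chain_weight (\<ge>) ks v) =
   (\<Sum>rs | growth rs \<and> length rs = n. chain_weight (\<le>) ks rs * of_nat (schur (growth_shape rs) m))"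
proof -
  define rec where "rec = (\<lambda>v :: nat list. THE rs. \<exists>P. rsk v P rs)"
  have rec: "rec v = rs \<longleftrightarrow> (\<exists>P. rsk v P rs)" for v rs
  proof -
    obtain P rs' where "rsk v P rs'" using rsk_exists by blast
    moreover then have "rec v = rs'" unfolding rec_def using rsk_unique by blast
    ultimately show ?thesis using rsk_unique by blast
  qed
  have "rec ` words n m \<subseteq> {rs. growth rs \<and> length rs = n}"
  proof
    fix rs assume "rs \<in> rec ` words n m"
    then obtain v where v: "v \<in> words n m" "rec v = rs" by blast
    then obtain P where "rsk v P rs" using rec by blast
    then show "rs \<in> {rs. growth rs \<and> length rs = n}"
      using rsk_invariants[of v P rs] v by (auto simp: words_def)
  qed
  then have "(\<Sum>v\<in>words n m. chain_weight (\<ge>) ks v) =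
     (\<Sum>rs | growth rs \<and> length rs = n. \<Sum>v | v \<in> words n m \<and> rec v = rs. chain_weight (\<ge>) ks v)"
    by (rule sum.group[OF finite_words finite_growths, symmetric])
  also have "\<dots> = (\<Sum>rs | growth rs \<and> length rs = n. chain_weight (\<le>) ks rs * of_nat (schur (growth_shape rs) m))"
  proof (rule sum.cong[OF refl])
    fix rs assume rs: "rs \<in> {rs. growth rs \<and> length rs = n}"
    have "(\<Sum>v | v \<in> words n m \<and> rec v = rs. chain_weight (\<ge>) ks v) =
        (\<Sum>v | v \<in> words n m \<and> rec v = rs. chain_weight (\<le>) ks rs)"
      by (rule sum.cong) (auto simp: rec chain_weight_rsk)
    also have "\<dots> = chain_weight (\<le>) ks rs * of_nat (schur (growth_shape rs) m)"
      using card_words_of_recording[of rs n m] rs by (simp add: rec mult.commute)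
    finally show "(\<Sum>v | v \<in> words n m \<and> rec v = rs. chain_weight (\<ge>) ks v) =
        chain_weight (\<le>) ks rs * of_nat (schur (growth_shape rs) m)" .
  qed
  finally show ?thesis .
qed

section \<open>Closure properties of Schur positivity\<close>

lemma schur_positive_single:
  assumes "is_partition \<mu>"
  shows "schur_positive (\<lambda>m. a * of_nat (schur \<mu> m))"
  unfolding schur_positive_def
  by (rule exI[of _ "Poly_Mapping.single \<mu> a"]) (use assms in \<open>auto simp: lookup_single\<close>)

lemma schur_positive_add:
  assumes "schur_positive F" "schur_positive G"
  shows "schur_positive (\<lambda>m. F m + G m)"
proof -
  obtain c where c: "\<forall>\<mu>\<in>Poly_Mapping.keys c. is_partition \<mu>"
    "\<And>m. F m = (\<Sum>\<mu>\<in>Poly_Mapping.keys c. Poly_Mapping.lookup c \<mu> * of_nat (schur \<mu> m))"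
    using assms(1) unfolding schur_positive_def by blast
  obtain d where d: "\<forall>\<mu>\<in>Poly_Mapping.keys d. is_partition \<mu>"
    "\<And>m. G m = (\<Sum>\<mu>\<in>Poly_Mapping.keys d. Poly_Mapping.lookup d \<mu> * of_nat (schur \<mu> m))"
    using assms(2) unfolding schur_positive_def by blast
  define K where "K = Poly_Mapping.keys c \<union> Poly_Mapping.keys d"
  have extend: "(\<Sum>\<mu>\<in>Poly_Mapping.keys e. Poly_Mapping.lookup e \<mu> * of_nat (schur \<mu> m)) =
      (\<Sum>\<mu>\<in>K. Poly_Mapping.lookup e \<mu> * of_nat (schur \<mu> m))"
    if "Poly_Mapping.keys e \<subseteq> K" for e :: "nat list \<Rightarrow>\<^sub>0 weight_poly" and m
    by (rule sum.mono_neutral_left) (use that in \<open>auto simp: K_def in_keys_iff\<close>)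
  have K: "Poly_Mapping.keys (c + d) \<subseteq> K" unfolding K_def by (rule keys_add)
  show ?thesis
    unfolding schur_positive_def
  proof (intro exI[of _ "c + d"] conjI allI)
    show "\<forall>\<mu>\<in>Poly_Mapping.keys (c + d). is_partition \<mu>" using K c d by (auto simp: K_def)
    show "F m + G m = (\<Sum>\<mu>\<in>Poly_Mapping.keys (c + d). Poly_Mapping.lookup (c + d) \<mu> * of_nat (schur \<mu> m))" for m
      unfolding c d extend[OF K] using extend[of c m] extend[of d m]
      by (simp add: K_def lookup_add distrib_right sum.distrib)
  qed
qed

lemma schur_positive_zero: "schur_positive (\<lambda>m. 0)"
  unfolding schur_positive_def by (rule exI[of _ 0]) simp

lemma schur_positive_sum:
  "(\<And>i. i \<in> I \<Longrightarrow> schur_positive (F i)) \<Longrightarrow> schur_positive (\<lambda>m. \<Sum>i\<in>I. F i m)"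
  by (induction I rule: infinite_finite_induct) (auto intro: schur_positive_zero schur_positive_add)

lemma schur_positive_chain_weight:
  "schur_positive (\<lambda>m. \<Sum>v\<in>words n m. chain_weight (\<ge>) ks v)"
  unfolding sum_chain_weight_words
  by (intro schur_positive_sum schur_positive_single) (auto intro: growth_partition)

section \<open>Trees with a given inorder and canopy\<close>

definition left_edge :: "weight_poly \<times> weight_poly" where
  "left_edge = (var Lambda_bar, var Lambda)"

definition right_edge :: "weight_poly \<times> weight_poly" where
  "right_edge = (var Rho_bar, var Rho)"

definition both_edges :: "weight_poly \<times> weight_poly" where
  "both_edges = (var Lambda_bar * var Rho_bar, var Lambda * var Rho)"

definition no_edge :: "weight_poly \<times> weight_poly" where
  "no_edge = (1, 1)"

text \<open>The endpoints come in inorder: a left child precedes its parent and a right child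
  follows it, so one comparison marks the ascents of both kinds.\<close>

definition edge :: "'w \<times> 'w \<Rightarrow> nat \<Rightarrow> nat \<Rightarrow> 'w" where
  "edge k x y = (if x \<le> y then fst k else snd k)"

text \<open>
  If \<open>x\<close> and \<open>w\<close> form an ascent, then \<open>x, z\<close> or \<open>z, w\<close> does, and likewise for descents; so
  \<open>L(x,w) = L(z,w)\<close> or \<open>R(x,z) = R(x,w)\<close>.
\<close>

lemma edge_exchange:
  "edge right_edge x z * edge left_edge x w + edge left_edge z w * edge right_edge x w =
   edge right_edge x z * edge left_edge z w + edge both_edges x w"
  by (auto simp: edge_def left_edge_def right_edge_def both_edges_def algebra_simps)

lemma weight_Leaf: "weight Leaf = 1"
  by (simp add: weight_def)

lemma weight_Node:
  "weight (Node l a r) =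
    (case l of Leaf \<Rightarrow> 1 | Node _ b _ \<Rightarrow> edge left_edge b a) *
    (case r of Leaf \<Rightarrow> 1 | Node _ b _ \<Rightarrow> edge right_edge a b) * weight l * weight r"
  by (cases l; cases r)
    (simp_all add: weight_def edge_def left_edge_def right_edge_def power_add mult_ac)

text \<open>The last node in inorder, which has no right child, contributes a final \<open>U\<close>.\<close>

definition full_canopy :: "'a tree \<Rightarrow> letter list" where
  "full_canopy t = map (\<lambda>v. if right v \<noteq> Leaf then D else U) (inorder_nodes t)"

lemma full_canopy_simps [simp]:
  "full_canopy Leaf = []"
  "full_canopy (Node l a r) = full_canopy l @ (if r = Leaf then U else D) # full_canopy r"
  by (simp_all add: full_canopy_def)

lemma length_full_canopy [simp]: "length (full_canopy t) = size t"
  by (induction t) auto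

lemma full_canopy_eq_Nil [simp]: "full_canopy t = [] \<longleftrightarrow> t = Leaf"
  by (cases t) auto

lemma last_full_canopy: "t \<noteq> Leaf \<Longrightarrow> last (full_canopy t) = U"
  by (induction t) auto

lemma canopy_iff: "t \<noteq> Leaf \<Longrightarrow> canopy t = \<nu> \<longleftrightarrow> full_canopy t = \<nu> @ [U]"
proof -
  assume "t \<noteq> Leaf"
  then have "full_canopy t = butlast (full_canopy t) @ [U]"
    using last_full_canopy[of t] append_butlast_last_id[of "full_canopy t"] by simp
  moreover have "canopy t = butlast (full_canopy t)"
    by (simp add: canopy_def full_canopy_def map_butlast)
  ultimately show ?thesis by (metis append1_eq_conv)
qed

text \<open>
  The new leaf comes after \<open>k\<close> nodes in inorder.  It becomes the right child of its predecessor if that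
  node has none, and otherwise the left child of its successor.
\<close>

fun insert_leaf :: "nat \<Rightarrow> 'a \<Rightarrow> 'a tree \<Rightarrow> 'a tree" where
  "insert_leaf k z Leaf = Node Leaf z Leaf"
| "insert_leaf k z (Node l a r) =
    (if k \<le> size l then Node (insert_leaf k z l) a r else Node l a (insert_leaf (k - size l - 1) z r))"

text \<open>The whole subtree at position \<open>k\<close> is discarded, so this undoes an insertion
  only where that node is a leaf.\<close>

fun delete_leaf :: "nat \<Rightarrow> 'a tree \<Rightarrow> 'a tree" where
  "delete_leaf k Leaf = Leaf"
| "delete_leaf k (Node l a r) =
    (if k < size l then Node (delete_leaf k l) a r
     else if k = size l then Leaf
     else Node l a (delete_leaf (k - size l - 1) r))"

lemma size_insert_leaf [simp]: "size (insert_leaf k z t) = Suc (size t)"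
  by (induction k z t rule: insert_leaf.induct) auto

lemma insert_leaf_neq_Leaf [simp]: "insert_leaf k z t \<noteq> Leaf"
  by (cases t) auto

lemma delete_insert_leaf: "k \<le> size t \<Longrightarrow> delete_leaf k (insert_leaf k z t) = t"
  by (induction k z t rule: insert_leaf.induct) auto

lemma inorder_insert_leaf:
  "k \<le> size t \<Longrightarrow> inorder (insert_leaf k z t) = take k (inorder t) @ z # drop k (inorder t)"
proof (induction k z t rule: insert_leaf.induct)
  case (2 k z l a r)
  show ?case
  proof (cases "k \<le> size l")
    case False
    then obtain j where "k = Suc (size l + j)" by (metis less_iff_Suc_add not_le)
    then show ?thesis using 2 by simp
  qed (use 2 in simp)
qed simp

text \<open>The effect of a new leaf on the letter of its predecessor, which has a right child
  afterwards: either it had one before, or the leaf becomes it. For \<open>k = 0\<close> there is no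
  predecessor.\<close>

definition put_D :: "nat \<Rightarrow> letter list \<Rightarrow> letter list" where
  "put_D k c = (if k = 0 then c else c[k - 1 := D])"

lemma length_put_D [simp]: "length (put_D k c) = length c"
  by (simp add: put_D_def)

lemma full_canopy_insert_leaf:
  "k \<le> size t \<Longrightarrow> full_canopy (insert_leaf k z t) =
    take k (put_D k (full_canopy t)) @ U # drop k (full_canopy t)"
proof (induction k z t rule: insert_leaf.induct)
  case (1 k z)
  then show ?case by (simp add: put_D_def)
next
  case (2 k z l a r)
  show ?case
  proof (cases "k \<le> size l")
    case True
    then show ?thesis using 2 by (auto simp: put_D_def list_update_append)
  next
    case False
    then obtain j where k: "k = Suc (size l + j)" by (metis less_iff_Suc_add not_le)
    show ?thesis
      using 2 k by (cases j; cases r) (auto simp: put_D_def list_update_append)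
  qed
qed

text \<open>The node at \<open>k\<close> is a leaf: its letter \<open>U\<close> excludes a right
  child, and a left child would make its predecessor the last node of the left subtree, with letter
  \<open>U\<close> instead of \<open>D\<close>.\<close>

lemma insert_delete_leaf:
  assumes "k < size t" "full_canopy t ! k = U" "k = 0 \<or> full_canopy t ! (k - 1) = D"
  shows "insert_leaf k (inorder t ! k) (delete_leaf k t) = t \<and> k \<le> size (delete_leaf k t)"
  using assms
proof (induction k t rule: delete_leaf.induct)
  case (2 k l a r)
  consider "k < size l" | "k = size l" | j where "k = Suc (size l + j)"
    by (metis less_iff_Suc_add linorder_neqE_nat)
  then show ?case
  proof cases
    case 1
    then show ?thesis using 2 by (auto simp: nth_append split: if_splits)
  next
    case 2
    then have r: "r = Leaf" using "2.prems" by (auto simp: nth_append split: if_splits)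
    have "l = Leaf"
    proof (rule ccontr)
      assume "l \<noteq> Leaf"
      then have "full_canopy l ! (size l - 1) = U" "size l > 0"
        using last_full_canopy[of l] last_conv_nth[of "full_canopy l"] by (auto simp: neq_Leaf_iff)
      then show False using "2.prems"(3) 2 by (simp add: nth_append)
    qed
    then show ?thesis using 2 r by simp
  next
    case 3
    have "j < size r" "full_canopy r ! j = U" using "2.prems" 3 by (auto simp: nth_append)
    moreover have "j = 0 \<or> full_canopy r ! (j - 1) = D"
      using "2.prems" 3 by (cases j) (auto simp: nth_append)
    ultimately show ?thesis using "2.IH"(2) 3 by (simp add: nth_append)
  qed
qed simp

text \<open>The weight of the one edge that the new leaf creates. For a nonempty tree and
  \<open>k = size t\<close> the last letter is \<open>U\<close>, so \<open>inorder t ! k\<close> is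
  never read out of range.\<close>

definition leaf_weight :: "nat \<Rightarrow> nat \<Rightarrow> nat tree \<Rightarrow> weight_poly" where
  "leaf_weight k z t =
    (if k > 0 \<and> full_canopy t ! (k - 1) = U then edge right_edge (inorder t ! (k - 1)) z
     else edge left_edge z (inorder t ! k))"

lemma weight_insert_leaf:
  "t \<noteq> Leaf \<Longrightarrow> k \<le> size t \<Longrightarrow> weight (insert_leaf k z t) = leaf_weight k z t * weight t"
proof (induction k z t rule: insert_leaf.induct)
  case ind: (2 k z l a r)
  \<comment> \<open>Insertion into a nonempty subtree keeps its root label, so the edge leading to
    it is unaffected.\<close>
  have root: "(case insert_leaf j z u of Leaf \<Rightarrow> 1 | Node _ b _ \<Rightarrow> h b) =
      (case u of Leaf \<Rightarrow> 1 | Node _ b _ \<Rightarrow> h b)" if "u \<noteq> Leaf" for h :: "nat \<Rightarrow> weight_poly" and j u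
    using that by (cases u) auto
  consider "l = Leaf" "k = 0" | "l \<noteq> Leaf" "k \<le> size l" | "r = Leaf" "k = Suc (size l)"
    | j where "r \<noteq> Leaf" "k = Suc (size l + j)"
  proof (cases "k \<le> size l")
    case True
    then show ?thesis using that(1,2) by (cases "l = Leaf") auto
  next
    case False
    then obtain j where "k = Suc (size l + j)" by (metis less_iff_Suc_add not_le)
    then show ?thesis using that(3,4) ind.prems by (cases "r = Leaf") auto
  qed
  then show ?case
  proof cases
    case 1
    then show ?thesis by (simp add: weight_Node weight_Leaf leaf_weight_def mult_ac)
  next
    case 2
    then have "size l > 0" by (auto simp: neq_Leaf_iff)
    then have "k < size l \<or> 0 < k \<and> full_canopy l ! (k - 1) = U"
      using 2 last_full_canopy[of l] last_conv_nth[of "full_canopy l"] by (auto simp: le_less)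
    then have "leaf_weight k z (Node l a r) = leaf_weight k z l"
      using \<open>size l > 0\<close> 2 by (auto simp: leaf_weight_def nth_append)
    then show ?thesis using 2 ind.IH(1) by (simp add: weight_Node root mult_ac)
  next
    case 3
    then show ?thesis by (simp add: weight_Node weight_Leaf leaf_weight_def nth_append mult_ac)
  next
    case 4
    then have "leaf_weight k z (Node l a r) = leaf_weight j z r"
      by (cases j) (auto simp: leaf_weight_def nth_append)
    then show ?thesis using 4 ind.IH(2) ind.prems by (simp add: weight_Node root mult_ac)
  qed
qed simp

section \<open>Recursions for the sum over trees\<close>

definition shape_sum :: "nat list \<Rightarrow> letter list \<Rightarrow> weight_poly" where
  "shape_sum xs c = (\<Sum>t | inorder t = xs \<and> full_canopy t = c. weight t)"

lemma finite_inorder: "finite {t. inorder t = xs \<and> Q t}"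
proof (rule finite_subset)
  show "{t. inorder t = xs \<and> Q t} \<subseteq> {t. size t = length xs \<and> set_tree t \<subseteq> set xs}"
    using length_inorder set_inorder by fastforce
qed (simp add: finite_trees)

text \<open>The letter \<open>U\<close> at the start or after a \<open>D\<close> forces
  \<open>z\<close> to sit at a leaf; deleting that leaf inverts \<open>insert_leaf\<close>, and the
  sum is reindexed along this bijection.\<close>

lemma shape_sum_leaf:
  assumes len: "length p = length pre" and p: "p = [] \<or> last p = D"
  shows "shape_sum (pre @ z # post) (p @ U # q) =
    (\<Sum>t | inorder t = pre @ post \<and> put_D (length pre) (full_canopy t) = p @ q.
      weight (insert_leaf (length pre) z t))"
proof -
  let ?k = "length pre"
  let ?A = "{t. inorder t = pre @ post \<and> put_D ?k (full_canopy t) = p @ q}"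
  let ?B = "{t. inorder t = pre @ z # post \<and> full_canopy t = p @ U # q}"
  have size: "?k \<le> size t" if "inorder t = pre @ post" for t
    using arg_cong[OF that, of length] by simp
  have drop_put_D: "drop ?k (put_D ?k c) = drop ?k c" for c
    by (simp add: put_D_def)
  have "insert_leaf ?k z ` ?A = ?B"
  proof (intro equalityI subsetI)
    fix t assume "t \<in> insert_leaf ?k z ` ?A"
    then obtain t' where t': "t = insert_leaf ?k z t'" "inorder t' = pre @ post"
      "put_D ?k (full_canopy t') = p @ q" by blast
    then have "drop ?k (full_canopy t') = q" using drop_put_D[of "full_canopy t'"] len by simp
    then show "t \<in> ?B"
      using t' len size[OF t'(2)] by (simp add: inorder_insert_leaf full_canopy_insert_leaf)
  next
    fix t assume t: "t \<in> ?B"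
    have "length (inorder t) = length (pre @ z # post)" using t by simp
    then have k: "?k < size t" by simp
    have U: "full_canopy t ! ?k = U" using t len by (simp add: nth_append)
    have D: "?k = 0 \<or> full_canopy t ! (?k - 1) = D"
      using t len p by (cases p rule: rev_cases) (auto simp: nth_append)
    have z: "inorder t ! ?k = z" using t by simp
    let ?t = "delete_leaf ?k t"
    have ins: "insert_leaf ?k z ?t = t" "?k \<le> size ?t"
      using insert_delete_leaf[OF k U D] z by auto
    have "take ?k (inorder ?t) @ z # drop ?k (inorder ?t) = pre @ z # post"
      using inorder_insert_leaf[OF ins(2), of z] ins(1) t by simp
    then have "take ?k (inorder ?t) = pre \<and> drop ?k (inorder ?t) = post"
      using ins(2) by (subst (asm) append_eq_append_conv) auto
    then have 1: "inorder ?t = pre @ post" by (metis append_take_drop_id)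
    have "take ?k (put_D ?k (full_canopy ?t)) @ U # drop ?k (full_canopy ?t) = p @ U # q"
      using full_canopy_insert_leaf[OF ins(2), of z] ins(1) t by simp
    then have "take ?k (put_D ?k (full_canopy ?t)) = p \<and> drop ?k (full_canopy ?t) = q"
      using ins(2) len by (subst (asm) append_eq_append_conv) auto
    then have "put_D ?k (full_canopy ?t) = p @ q"
      using drop_put_D by (metis append_take_drop_id)
    then show "t \<in> insert_leaf ?k z ` ?A" using 1 ins(1) by (intro image_eqI[of _ _ ?t]) auto
  qed
  moreover have "inj_on (insert_leaf ?k z) ?A"
    by (rule inj_on_inverseI[where g = "delete_leaf ?k"]) (use size in \<open>auto simp: delete_insert_leaf\<close>)
  ultimately show ?thesis
    unfolding shape_sum_def by (metis (no_types, lifting) sum.reindex_cong)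
qed

text \<open>The first node is a leaf without predecessor, hence the left child of the second
  one.\<close>

lemma shape_sum_first:
  "shape_sum (x # w # ys) (U # q) = edge left_edge x w * shape_sum (w # ys) q"
proof -
  have "shape_sum (x # w # ys) (U # q) =
      (\<Sum>t | inorder t = w # ys \<and> full_canopy t = q. weight (insert_leaf 0 x t))"
    using shape_sum_leaf[of "[]" "[]" x "w # ys" q] by (simp add: put_D_def)
  also have "\<dots> = (\<Sum>t | inorder t = w # ys \<and> full_canopy t = q. edge left_edge x w * weight t)"
    by (rule sum.cong[OF refl], subst weight_insert_leaf) (auto simp: leaf_weight_def)
  finally show ?thesis by (simp add: shape_sum_def sum_distrib_left)
qed

text \<open>Only one letter is forgotten, so there are two preimages; they give the two terms of
  \<open>shape_sum_inner\<close>.\<close>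

lemma put_D_Suc_eq_iff:
  "length xs = length \<alpha> \<Longrightarrow> put_D (Suc (length xs)) c = \<alpha> @ D # q \<longleftrightarrow> c = \<alpha> @ U # q \<or> c = \<alpha> @ D # q"
proof
  assume h: "length xs = length \<alpha>" "put_D (Suc (length xs)) c = \<alpha> @ D # q"
  have "length (put_D (Suc (length xs)) c) = length (\<alpha> @ D # q)" unfolding h(2) ..
  then have "length \<alpha> < length c" by simp
  then have "c = take (length \<alpha>) c @ c ! length \<alpha> # drop (Suc (length \<alpha>)) c" by (rule id_take_nth_drop)
  moreover have "put_D (Suc (length xs)) c = take (length \<alpha>) c @ D # drop (Suc (length \<alpha>)) c"
    using h(1) \<open>length \<alpha> < length c\<close> by (simp add: put_D_def upd_conv_take_nth_drop)
  ultimately have "c = \<alpha> @ c ! length \<alpha> # q"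
    using h \<open>length \<alpha> < length c\<close> by (simp add: append_eq_append_conv)
  then show "c = \<alpha> @ U # q \<or> c = \<alpha> @ D # q" by (cases "c ! length \<alpha>") auto
qed (auto simp: put_D_def)

text \<open>Once the leaf \<open>z\<close> is deleted, \<open>x\<close> has letter \<open>U\<close>
  if \<open>z\<close> was its right child, and letter \<open>D\<close> if \<open>z\<close> was the
  left child of \<open>w\<close>.\<close>

lemma shape_sum_inner:
  assumes "length xs = length \<alpha>"
  shows "shape_sum (xs @ x # z # w # ys) (\<alpha> @ D # U # q) =
    edge right_edge x z * shape_sum (xs @ x # w # ys) (\<alpha> @ U # q) +
    edge left_edge z w * shape_sum (xs @ x # w # ys) (\<alpha> @ D # q)"
proof -
  let ?k = "Suc (length xs)" and ?l = "xs @ x # w # ys"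
  let ?T = "\<lambda>c. {t. inorder t = ?l \<and> full_canopy t = c}"
  have "shape_sum (xs @ x # z # w # ys) (\<alpha> @ D # U # q) =
      (\<Sum>t | inorder t = ?l \<and> put_D ?k (full_canopy t) = \<alpha> @ D # q. weight (insert_leaf ?k z t))"
    using shape_sum_leaf[of "\<alpha> @ [D]" "xs @ [x]" z "w # ys" q] assms by simp
  also have "{t. inorder t = ?l \<and> put_D ?k (full_canopy t) = \<alpha> @ D # q} =
      ?T (\<alpha> @ U # q) \<union> ?T (\<alpha> @ D # q)"
    using put_D_Suc_eq_iff[OF assms] by blast
  also have "(\<Sum>t\<in>?T (\<alpha> @ U # q) \<union> ?T (\<alpha> @ D # q). weight (insert_leaf ?k z t)) =
      (\<Sum>t\<in>?T (\<alpha> @ U # q). weight (insert_leaf ?k z t)) + (\<Sum>t\<in>?T (\<alpha> @ D # q). weight (insert_leaf ?k z t))"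
    by (rule sum.union_disjoint) (auto intro: finite_inorder)
  also have "(\<Sum>t\<in>?T (\<alpha> @ U # q). weight (insert_leaf ?k z t)) =
      edge right_edge x z * shape_sum ?l (\<alpha> @ U # q)"
    unfolding shape_sum_def sum_distrib_left
  proof (rule sum.cong[OF refl])
    fix t assume t: "t \<in> ?T (\<alpha> @ U # q)"
    then have "length (inorder t) = length ?l" by simp
    then show "weight (insert_leaf ?k z t) = edge right_edge x z * weight t"
      using t assms by (subst weight_insert_leaf) (auto simp: leaf_weight_def nth_append)
  qed
  also have "(\<Sum>t\<in>?T (\<alpha> @ D # q). weight (insert_leaf ?k z t)) =
      edge left_edge z w * shape_sum ?l (\<alpha> @ D # q)"
    unfolding shape_sum_def sum_distrib_left
  proof (rule sum.cong[OF refl])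
    fix t assume t: "t \<in> ?T (\<alpha> @ D # q)"
    then have "length (inorder t) = length ?l" by simp
    then show "weight (insert_leaf ?k z t) = edge left_edge z w * weight t"
      using t assms by (subst weight_insert_leaf) (auto simp: leaf_weight_def nth_append)
  qed
  finally show ?thesis .
qed

text \<open>No node follows \<open>z\<close>, and a full canopy never ends in \<open>D\<close>, so
  only the term with \<open>z\<close> as right child of \<open>x\<close> survives.\<close>

lemma shape_sum_last:
  assumes "length xs = length \<alpha>"
  shows "shape_sum (xs @ [x, z]) (\<alpha> @ [D, U]) = edge right_edge x z * shape_sum (xs @ [x]) (\<alpha> @ [U])"
proof -
  let ?k = "Suc (length xs)" and ?l = "xs @ [x]"
  have D: "full_canopy t \<noteq> \<alpha> @ [D]" for t :: "nat tree"
    using last_full_canopy[of t] by (cases "t = Leaf") (metis full_canopy_eq_Nil append_is_Nil_conv list.simps(3), metis last_snoc letter.distinct(1))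
  have "shape_sum (xs @ [x, z]) (\<alpha> @ [D, U]) =
      (\<Sum>t | inorder t = ?l \<and> put_D ?k (full_canopy t) = \<alpha> @ [D]. weight (insert_leaf ?k z t))"
    using shape_sum_leaf[of "\<alpha> @ [D]" "xs @ [x]" z "[]" "[]"] assms by simp
  also have "\<dots> = (\<Sum>t | inorder t = ?l \<and> full_canopy t = \<alpha> @ [U]. edge right_edge x z * weight t)"
  proof (rule sum.cong)
    show "{t. inorder t = ?l \<and> put_D ?k (full_canopy t) = \<alpha> @ [D]} =
        {t. inorder t = ?l \<and> full_canopy t = \<alpha> @ [U]}"
      using put_D_Suc_eq_iff[OF assms] D by blast
    fix t assume t: "t \<in> {t. inorder t = ?l \<and> full_canopy t = \<alpha> @ [U]}"
    then have "length (inorder t) = length ?l" by simp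
    then show "weight (insert_leaf ?k z t) = edge right_edge x z * weight t"
      using t assms by (subst weight_insert_leaf) (auto simp: leaf_weight_def nth_append)
  qed
  finally show ?thesis by (simp add: shape_sum_def sum_distrib_left)
qed

section \<open>The same recursions for noncrossing matchings\<close>

text \<open>
  The sum over the noncrossing matchings, reading the canopy from left to right: the stack \<open>st\<close> holds the
  labels of the nodes in front of those matched letters \<open>D\<close> whose partner has not been read yet.
\<close>

fun matching_sum :: "nat list \<Rightarrow> nat list \<Rightarrow> letter list \<Rightarrow> weight_poly" where
  "matching_sum [] [x] [] = 1"
| "matching_sum st (x # y # ys) (U # \<nu>) = edge left_edge x y * matching_sum st (y # ys) \<nu> +
    (case st of [] \<Rightarrow> 0 | s # st' \<Rightarrow> edge both_edges s y * matching_sum st' (y # ys) \<nu>)"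
| "matching_sum st (x # y # ys) (D # \<nu>) = edge right_edge x y * matching_sum st (y # ys) \<nu> +
    matching_sum (x # st) (y # ys) \<nu>"
| "matching_sum _ _ _ = 0"

text \<open>A common prefix unfolds alike on both sides. At the factor \<open>D U\<close> the terms
  agree by \<open>edge_exchange\<close>, which absorbs the case where these two letters are matched
  with each other.\<close>

lemma matching_sum_inner:
  "length xs = length \<alpha> \<Longrightarrow> matching_sum st (xs @ x # z # w # ys) (\<alpha> @ D # U # \<nu>) =
    edge right_edge x z * matching_sum st (xs @ x # w # ys) (\<alpha> @ U # \<nu>) +
    edge left_edge z w * matching_sum st (xs @ x # w # ys) (\<alpha> @ D # \<nu>)"
proof (induction xs \<alpha> arbitrary: st rule: list_induct2)
  case Nil
  have "matching_sum st (x # z # w # ys) (D # U # \<nu>) =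
    (edge right_edge x z * edge left_edge z w + edge both_edges x w) * matching_sum st (w # ys) \<nu> +
    edge right_edge x z * (case st of [] \<Rightarrow> 0 | s # st' \<Rightarrow> edge both_edges s w * matching_sum st' (w # ys) \<nu>) +
    edge left_edge z w * matching_sum (x # st) (w # ys) \<nu>"
    by (simp add: algebra_simps)
  also have "\<dots> = edge right_edge x z * matching_sum st (x # w # ys) (U # \<nu>) +
    edge left_edge z w * matching_sum st (x # w # ys) (D # \<nu>)"
    unfolding edge_exchange[symmetric] by (simp add: algebra_simps)
  finally show ?case by simp
next
  case (Cons a xs c \<alpha>)
  obtain b bs where b: "xs @ x # w # ys = b # bs" "\<And>v. xs @ x # v = b # (tl (xs @ x # v))"
    by (cases xs) auto
  show ?case
    using Cons.IH b by (cases c; cases st; cases xs) (auto simp: algebra_simps)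
qed

text \<open>A final \<open>D\<close> has no later partner: pushing \<open>x\<close> would leave the
  stack nonempty at the end, which counts as zero.\<close>

lemma matching_sum_last:
  "length xs = length \<alpha> \<Longrightarrow> matching_sum st (xs @ [x, z]) (\<alpha> @ [D]) =
    edge right_edge x z * matching_sum st (xs @ [x]) \<alpha>"
proof (induction xs \<alpha> arbitrary: st rule: list_induct2)
  case Nil
  then show ?case by (cases st) auto
next
  case (Cons a xs c \<alpha>)
  then show ?case by (cases c; cases st; cases xs) (auto simp: algebra_simps)
qed

lemma shape_sum_eq_matching_sum:
  "length xs = Suc (length \<nu>) \<Longrightarrow> shape_sum xs (\<nu> @ [U]) = matching_sum [] xs \<nu>"
proof (induction "length \<nu>" arbitrary: xs \<nu> rule: less_induct)
  case less
  \<comment> \<open>The first \<open>U\<close> is either initial or preceded by \<open>D\<close>; a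
    word without \<open>U\<close> is empty or ends in \<open>D\<close>.\<close>
  consider "\<nu> = []" | q where "\<nu> = U # q" | \<alpha> q where "\<nu> = \<alpha> @ D # U # q" | \<alpha> where "\<nu> = \<alpha> @ [D]"
  proof (cases "U \<in> set \<nu>")
    case True
    then obtain p q where p: "\<nu> = p @ U # q" "U \<notin> set p" by (metis split_list_first)
    then show ?thesis using that by (cases p rule: rev_cases) (auto, metis letter.exhaust)
  next
    case False
    then show ?thesis using that by (cases \<nu> rule: rev_cases) (auto, metis letter.exhaust)
  qed
  then show ?case
  proof cases
    case 1
    then obtain x where x: "xs = [x]" using less.prems by (auto simp: length_Suc_conv)
    have "{t. inorder t = [x] \<and> full_canopy t = [U]} = {Node Leaf x Leaf}"
    proof -
      have "t = Node Leaf x Leaf" if "inorder t = [x]" for t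
        using that by (cases t) (auto simp: append_eq_Cons_conv)
      then show ?thesis by auto
    qed
    then show ?thesis using 1 x by (simp add: shape_sum_def weight_Node weight_Leaf)
  next
    case (2 q)
    then obtain x w ys where "xs = x # w # ys" using less.prems by (auto simp: length_Suc_conv)
    then show ?thesis using 2 less.hyps[of q "w # ys"] less.prems by (simp add: shape_sum_first)
  next
    case (3 \<alpha> q)
    let ?ys = "drop (length \<alpha>) xs"
    obtain x z w ys where ys: "?ys = x # z # w # ys"
      using less.prems 3 by (cases ?ys; cases "tl ?ys"; cases "tl (tl ?ys)") (auto dest: arg_cong[of _ _ length])
    define us where "us = take (length \<alpha>) xs"
    have xs: "xs = us @ x # z # w # ys" and len: "length us = length \<alpha>"
      using ys less.prems 3 by (auto simp: us_def) (metis append_take_drop_id)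
    have "shape_sum xs (\<nu> @ [U]) = matching_sum [] xs \<nu>"
      using less.hyps[of "\<alpha> @ U # q" "us @ x # w # ys"] less.hyps[of "\<alpha> @ D # q" "us @ x # w # ys"] less.prems
      unfolding 3 xs by (simp add: shape_sum_inner[OF len] matching_sum_inner[OF len])
    then show ?thesis .
  next
    case (4 \<alpha>)
    then obtain us x z where xs: "xs = us @ [x, z]" and len: "length us = length \<alpha>"
      using less.prems by (cases xs rule: rev_cases; cases "butlast xs" rule: rev_cases) auto
    then show ?thesis
      using less.hyps[of \<alpha> "us @ [x]"] 4 by (simp add: shape_sum_last matching_sum_last)
  qed
qed

section \<open>Paths of noncrossing matchings\<close>

text \<open>
  The words obtained from the noncrossing matchings: \<open>st\<close> and \<open>p\<close> are the unfinished paths, with their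
  latest node first, and the finished ones are concatenated in \<open>acc\<close>.  Every node carries the weights of
  the edge to its predecessor in its path; the first node of a path carries \<open>no_edge\<close>, so that
  concatenation multiplies weights.
\<close>

fun matching_paths :: "((weight_poly \<times> weight_poly) \<times> nat) list list \<Rightarrow>
    ((weight_poly \<times> weight_poly) \<times> nat) list \<Rightarrow> ((weight_poly \<times> weight_poly) \<times> nat) list \<Rightarrow>
    nat list \<Rightarrow> letter list \<Rightarrow> ((weight_poly \<times> weight_poly) \<times> nat) list list" where
  "matching_paths [] p acc [] [] = [p @ acc]"
| "matching_paths st p acc (y # ys) (U # \<nu>) = matching_paths st ((left_edge, y) # p) acc ys \<nu> @
    (case st of [] \<Rightarrow> [] | s # st' \<Rightarrow> matching_paths st' ((both_edges, y) # s) (p @ acc) ys \<nu>)"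
| "matching_paths st p acc (y # ys) (D # \<nu>) = matching_paths st ((right_edge, y) # p) acc ys \<nu> @
    matching_paths (p # st) [(no_edge, y)] acc ys \<nu>"
| "matching_paths _ _ _ _ _ = []"

text \<open>Paths store node indices, so they depend on the canopy only, and \<open>f\<close>
  supplies the labels. As the latest node comes first, ascents along a path are tested by
  \<open>(\<ge>)\<close>.\<close>

definition path_weight ::
    "(nat \<Rightarrow> nat) \<Rightarrow> ((weight_poly \<times> weight_poly) \<times> nat) list \<Rightarrow> weight_poly" where
  "path_weight f t = chain_weight (\<ge>) (map fst t) (map (f \<circ> snd) t)"

definition closed_path :: "((weight_poly \<times> weight_poly) \<times> nat) list \<Rightarrow> bool" where
  "closed_path p \<longleftrightarrow> p \<noteq> [] \<and> fst (last p) = no_edge"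

lemma path_weight_Cons: "p \<noteq> [] \<Longrightarrow>
    path_weight f ((k, y) # p) = edge k (f (snd (hd p))) (f y) * path_weight f p"
  by (cases p) (auto simp: path_weight_def edge_def)

lemma path_weight_append: "closed_path p \<Longrightarrow> path_weight f (p @ acc) = path_weight f p * path_weight f acc"
proof (induction p)
  case (Cons a p)
  obtain k y where a: "a = (k, y)" by (cases a)
  show ?case
  proof (cases "p = []")
    case True
    then show ?thesis using Cons.prems a
      by (cases acc) (auto simp: path_weight_Cons closed_path_def edge_def no_edge_def path_weight_def)
  next
    case False
    then show ?thesis using Cons a by (simp add: path_weight_Cons closed_path_def mult.assoc)
  qed
qed (simp add: closed_path_def)

lemma closed_path_Cons: "closed_path p \<Longrightarrow> closed_path (a # p)"
  by (simp add: closed_path_def)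

lemma closed_path_single: "closed_path [(no_edge, y)]"
  by (simp add: closed_path_def)

lemma path_weight_single: "path_weight f [a] = 1"
  by (cases a) (simp add: path_weight_def)

text \<open>The heads of the unfinished paths are the stack of \<open>matching_sum\<close>, and the
  path weights are the factors collected so far. At a matched \<open>U\<close> the current path
  moves to \<open>acc\<close> and the path on top of the stack continues.\<close>

lemma sum_matching_paths:
  "closed_path p \<Longrightarrow> \<forall>s\<in>set st. closed_path s \<Longrightarrow>
   (\<Sum>t\<leftarrow>matching_paths st p acc ys \<nu>. path_weight f t) =
     prod_list (map (path_weight f) st) * path_weight f p * path_weight f acc *
     matching_sum (map (\<lambda>s. f (snd (hd s))) st) (f (snd (hd p)) # map f ys) \<nu>"
proof (induction st p acc ys \<nu> rule: matching_paths.induct)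
  case (1 p acc)
  then show ?case by (simp add: path_weight_append)
next
  case (2 st p acc y ys \<nu>)
  then have p: "p \<noteq> []" by (simp add: closed_path_def)
  show ?case
  proof (cases st)
    case Nil
    then show ?thesis using 2 p by (simp add: path_weight_Cons closed_path_Cons algebra_simps)
  next
    case (Cons s st')
    then have s: "s \<noteq> []" "closed_path s" using 2 by (auto simp: closed_path_def)
    have "(\<Sum>t\<leftarrow>matching_paths st' ((both_edges, y) # s) (p @ acc) ys \<nu>. path_weight f t) =
       prod_list (map (path_weight f) st') * path_weight f ((both_edges, y) # s) * path_weight f (p @ acc) *
       matching_sum (map (\<lambda>s. f (snd (hd s))) st') (f y # map f ys) \<nu>"
      using "2.IH"(2)[OF Cons] "2.prems" Cons s by (simp add: closed_path_Cons)
    then show ?thesis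
      using 2 p s Cons by (simp add: path_weight_Cons closed_path_Cons path_weight_append algebra_simps)
  qed
next
  case (3 st p acc y ys \<nu>)
  then have p: "p \<noteq> []" by (simp add: closed_path_def)
  show ?case
    using 3 p by (simp add: path_weight_Cons closed_path_Cons closed_path_single path_weight_single algebra_simps)
qed auto

text \<open>Every node ends up in the resulting word exactly once, so the word is a rearrangement of
  the nodes.\<close>

lemma mset_matching_paths:
  "t \<in> set (matching_paths st p acc ys \<nu>) \<Longrightarrow>
   mset (map snd t) = mset (map snd (concat st @ p @ acc)) + mset ys"
  by (induction st p acc ys \<nu> rule: matching_paths.induct) (auto split: list.splits)

text \<open>A fixed rearrangement of positions preserves content and is injective on the finite set
  of words, hence permutes it.\<close>

lemma sum_words_permute:
  assumes p: "mset p = mset [0..<n]"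
  shows "(\<Sum>v\<in>words n m. h (map (nth v) p)) = (\<Sum>v\<in>words n m. h v)"
proof -
  let ?g = "\<lambda>v :: nat list. map (nth v) p"
  have "mset (?g v) = mset v" if "length v = n" for v
    using p map_nth[of v] that by (metis mset_map)
  then have mset: "mset (?g v) = mset v" if "v \<in> words n m" for v
    using that by (auto simp: words_def)
  have "?g ` words n m \<subseteq> words n m"
  proof
    fix w assume "w \<in> ?g ` words n m"
    then obtain v where v: "w = ?g v" "v \<in> words n m" by blast
    then show "w \<in> words n m"
      using mset[OF v(2)] word_monomial_mset mset_eq_setD mset_eq_length
      unfolding words_def by (metis (mono_tags, lifting) mem_Collect_eq)
  qed
  moreover have inj: "inj_on ?g (words n m)"
  proof (rule inj_onI)
    fix v w assume v: "v \<in> words n m" "w \<in> words n m" "?g v = ?g w"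
    have "set p = {0..<n}" using mset_eq_setD[OF p] by simp
    then show "v = w" using v by (auto intro!: nth_equalityI simp: words_def)
  qed
  ultimately have "?g ` words n m = words n m"
    by (intro endo_inj_surj finite_words)
  then show ?thesis using sum.reindex[OF inj, of h] by simp
qed

section \<open>Passing from trees to words\<close>

lemma schur_positive_sum_list:
  "(\<And>t. t \<in> set ts \<Longrightarrow> schur_positive (F t)) \<Longrightarrow> schur_positive (\<lambda>m. \<Sum>t\<leftarrow>ts. F t m)"
  by (induction ts) (auto intro: schur_positive_zero schur_positive_add)

text \<open>Trees are grouped by their inorder word. Positivity of \<open>n\<close> rules out the
  empty tree, whose full canopy has no final \<open>U\<close>.\<close>

lemma tree_gf_eq_sum_words:
  assumes "0 < n"
  shows "tree_gf n \<nu> m = (\<Sum>v\<in>words n m. shape_sum v (\<nu> @ [U]))"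
proof -
  let ?A = "{t \<in> labeled_trees n \<nu>. tree_monomial t = m}"
  have A: "t \<in> ?A \<longleftrightarrow> inorder t \<in> words n m \<and> full_canopy t = \<nu> @ [U]" for t
  proof (cases "t = Leaf")
    case False
    then show ?thesis
      by (auto simp: labeled_trees_def words_def tree_monomial_def word_monomial_def canopy_iff intro!: gr0I)
  qed (use assms in \<open>auto simp: labeled_trees_def words_def\<close>)
  have "tree_gf n \<nu> m = (\<Sum>v\<in>words n m. \<Sum>t | t \<in> ?A \<and> inorder t = v. weight t)"
    unfolding tree_gf_def
  proof (rule sum.group[symmetric])
    show "inorder ` ?A \<subseteq> words n m" using A by blast
  qed (rule finite_labeled_trees_monomial finite_words)+
  also have "\<dots> = (\<Sum>v\<in>words n m. shape_sum v (\<nu> @ [U]))"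
    unfolding shape_sum_def A by (intro sum.cong) auto
  finally show ?thesis .
qed

theorem theorem1p5:
  fixes n :: nat and \<nu> :: "letter list"
  assumes "0 < n" and "length \<nu> = n - 1"
  shows "schur_positive (tree_gf n \<nu>)"
proof -
  \<comment> \<open>Nodes are indexed by inorder position; node \<open>0\<close> opens the first
    path and has no predecessor.\<close>
  let ?ts = "matching_paths [] [(no_edge, 0)] [] [1..<n] \<nu>"
  have shape: "shape_sum v (\<nu> @ [U]) = (\<Sum>t\<leftarrow>?ts. chain_weight (\<ge>) (map fst t) (map (nth v) (map snd t)))"
    if "v \<in> words n m" for v m
  proof -
    have len: "length v = n" using that by (simp add: words_def)
    then have v: "v ! 0 # map (nth v) [1..<n] = v"
      using assms(1) map_nth[of v] by (simp add: upt_conv_Cons)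
    have "shape_sum v (\<nu> @ [U]) = matching_sum [] v \<nu>"
      using assms len by (intro shape_sum_eq_matching_sum) simp
    also have "\<dots> = (\<Sum>t\<leftarrow>?ts. path_weight (nth v) t)"
      using sum_matching_paths[of "[(no_edge, 0)]" "[]" "nth v" "[]" "[1..<n]" \<nu>] v
      by (simp add: closed_path_single path_weight_single) (simp add: path_weight_def)
    finally show ?thesis by (simp add: path_weight_def)
  qed
  have perm: "mset (map snd t) = mset [0..<n]" if "t \<in> set ?ts" for t
    using mset_matching_paths[OF that] assms(1) by (simp add: upt_conv_Cons)
  have swap: "(\<Sum>v\<in>A. \<Sum>t\<leftarrow>ts. h t v) = (\<Sum>t\<leftarrow>ts. \<Sum>v\<in>A. h t v)"
    for A :: "nat list set" and ts and h :: "((weight_poly \<times> weight_poly) \<times> nat) list \<Rightarrow> nat list \<Rightarrow> weight_poly"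
    by (induction ts) (auto simp: sum.distrib)
  have "tree_gf n \<nu> = (\<lambda>m. \<Sum>t\<leftarrow>?ts. \<Sum>v\<in>words n m. chain_weight (\<ge>) (map fst t) v)"
  proof
    fix m
    have "tree_gf n \<nu> m = (\<Sum>v\<in>words n m. \<Sum>t\<leftarrow>?ts. chain_weight (\<ge>) (map fst t) (map (nth v) (map snd t)))"
      unfolding tree_gf_eq_sum_words[OF assms(1)] by (rule sum.cong) (use shape in auto)
    also have "\<dots> = (\<Sum>t\<leftarrow>?ts. \<Sum>v\<in>words n m. chain_weight (\<ge>) (map fst t) (map (nth v) (map snd t)))"
      by (rule swap)
    \<comment> \<open>The rearrangement along the paths depends on \<open>t\<close> but not on
      \<open>v\<close>, so it disappears in the sum over all words.\<close>
    also have "\<dots> = (\<Sum>t\<leftarrow>?ts. \<Sum>v\<in>words n m. chain_weight (\<ge>) (map fst t) v)"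
      using sum_words_permute[OF perm] by (intro arg_cong[of _ _ sum_list] map_cong[OF refl]) auto
    finally show "tree_gf n \<nu> m = (\<Sum>t\<leftarrow>?ts. \<Sum>v\<in>words n m. chain_weight (\<ge>) (map fst t) v)" .
  qed
  then show ?thesis
    by (simp add: schur_positive_sum_list schur_positive_chain_weight)
qed

end
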